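(* Let $R$ be a finite Frobenius ring and let $w$ be the homogeneous weight on $R$ computed for $\gamma = |R^\times|$, extended additively to $R^n$. Let $C \le {}_RR^n$ be a left linear code that is a proper, regular, projective two-weight code with nonzero weights $w_1<w_2$. Then there exist a positive integer $d$, a divisor of $|C|$, and a positive integer $t$ such that $w_1 = dt$ and $w_2 = d(t+1)$.
   Context: Rings are associative with identity $1\neq 0$; $R^\times$ is the unit group of $R$. A finite ring $R$ is Frobenius if ${}_RR\cong{}_R\hat R$ as left $R$-modules, where $\hat R=\mathrm{Hom}_{\mathbb Z}(R,\mathbb C^\times)$ is the group of additive characters with $({}^r\chi)(x)=\chi(rx)$ and $\chi^r(x)=\chi(xr)$ giving its bimodule structure (equivalently, ${}_R(R/\mathrm{Rad}\,R)\cong \mathrm{Soc}({}_RR)$). Homogeneous weight: let $\mu$ be the Möbius function on the set of left principal ideals of $R$ ordered by inclusion, i.e. $\mu(Rx,Rx)=1$, $\mu(Ry,Rx)=0$ if $Ry\not\le Rx$, and $\sum_{Ry\le Rz\le Rx}\mu(Rz,Rx)=0$ (sum over left principal ideals $Rz$) if $Ry<Rx$. For a real constant $\gamma$ the homogeneous weight is $w(x)=\gamma\left(1-\frac{\mu(0,Rx)}{|R^\times x|}\right)$, $x\in R$. (For $\gamma=|R^\times|$ it is integer-valued.) It is extended to $R^n$ by $w(c_1,\dots,c_n)=\sum_{i=1}^n w(c_i)$. Codes: a left linear code $C\le {}_RR^n$ is a left $R$-submodule. Let $Y=(y_1|\cdots|y_n)$ be an $\ell\times n$ generator matrix of $C$,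 i.e. $C=\{xY: x\in R^\ell\}$ (rows need not be independent). $C$ is proper if $w(c)=0$ implies $c=0$ for all $c\in C$; regular if $\{x\cdot y_i: x\in R^\ell\}=R$ for each $i$; projective if $y_iR\ne y_jR$ for all distinct $i,j\in\{1,\dots,n\}$. These notions do not depend on the choice of $Y$. A two-weight code with nonzero weights $w_1<w_2$ is a code for which exactly the two nonzero values $w_1,w_2$ occur as weights of codewords. *)

theory Defs
  imports Complex_Main "Jordan_Normal_Form.Matrix"
begin

section \<open>Finite Frobenius rings\<close>

text \<open>The ring is the type \<open>'a :: {ring_1, finite}\<close>, not assumed commutative.
  The character group is $\mathrm{Hom}_{\mathbb Z}(R,\mathbb C^\times)$.\<close>

definition additive_character :: "('a::ring_1 \<Rightarrow> complex) \<Rightarrow> bool" where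
  "additive_character \<chi> \<longleftrightarrow> (\<forall>x. \<chi> x \<noteq> 0) \<and> (\<forall>x y. \<chi> (x + y) = \<chi> x * \<chi> y)"

text \<open>The left scalar action is $({}^r\chi)(x) = \chi(xr)$. The factor has to stand on
  the right: $({}^r\chi)(x) = \chi(rx)$ would give
  ${}^s({}^r\chi) = {}^{rs}\chi$, which is a right action.\<close>

definition char_scale :: "'a::ring_1 \<Rightarrow> ('a \<Rightarrow> complex) \<Rightarrow> ('a \<Rightarrow> complex)" where
  "char_scale r \<chi> = (\<lambda>x. \<chi> (x * r))"

lemma char_scale_mult: "char_scale s (char_scale r \<chi>) = char_scale (s * r) \<chi>"
  by (simp add: char_scale_def mult.assoc)

text \<open>The witness \<open>\<phi>\<close> is an isomorphism of left modules from $R$ onto its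
  (multiplicatively written) character group.\<close>

definition frobenius_ring :: "'a::{ring_1,finite} itself \<Rightarrow> bool" where
  "frobenius_ring _ \<longleftrightarrow>
     (\<exists>\<phi> :: 'a \<Rightarrow> 'a \<Rightarrow> complex.
        bij_betw \<phi> UNIV {\<chi>. additive_character \<chi>} \<and>
        (\<forall>x y. \<phi> (x + y) = (\<lambda>z. \<phi> x z * \<phi> y z)) \<and>
        (\<forall>r x. \<phi> (r * x) = char_scale r (\<phi> x)))"

section \<open>The homogeneous weight\<close>

definition left_principal_ideal :: "'a::ring_1 \<Rightarrow> 'a set" where
  "left_principal_ideal x = {r * x | r. True}"

definition left_principal_ideals :: "'a::ring_1 set set" where
  "left_principal_ideals = range left_principal_ideal"

text \<open>The recursion solves $\sum_{Ry\le Rz\le Rx}\mu(Rz,Rx)=0$ for its summand at $Rz = Ry$.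
  It is stated for arbitrary subsets of the ring, but only its values on left
  principal ideals matter; see \<open>lpi_moebius_char\<close> below.\<close>

function lpi_moebius :: "'a::{ring_1,finite} set \<Rightarrow> 'a set \<Rightarrow> int" where
  "lpi_moebius A B =
     (if A = B then 1
      else if A \<subset> B then - (\<Sum>I \<in> {I \<in> left_principal_ideals. A \<subset> I \<and> I \<subseteq> B}. lpi_moebius I B)
      else 0)"
  by auto
termination
  by (relation "measure (\<lambda>(A, B). card (- A))") (auto intro!: psubset_card_mono)

declare lpi_moebius.simps [simp del]

lemma lpi_moebius_char:
  fixes x y :: "'a::{ring_1,finite}"
  shows "lpi_moebius (left_principal_ideal x) (left_principal_ideal x) = 1"
    and "\<not> left_principal_ideal y \<subseteq> left_principal_ideal x \<Longrightarrow>
           lpi_moebius (left_principal_ideal y) (left_principal_ideal x) = 0"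
    and "left_principal_ideal y \<subset> left_principal_ideal x \<Longrightarrow>
           (\<Sum>I \<in> {I \<in> left_principal_ideals.
                    left_principal_ideal y \<subseteq> I \<and> I \<subseteq> left_principal_ideal x}.
              lpi_moebius I (left_principal_ideal x)) = 0"
proof -
  show "lpi_moebius (left_principal_ideal x) (left_principal_ideal x) = 1"
    by (subst lpi_moebius.simps) simp
  show "lpi_moebius (left_principal_ideal y) (left_principal_ideal x) = 0"
    if "\<not> left_principal_ideal y \<subseteq> left_principal_ideal x"
    using that by (subst lpi_moebius.simps) auto
  assume less: "left_principal_ideal y \<subset> left_principal_ideal x"
  let ?A = "left_principal_ideal y" and ?B = "left_principal_ideal x"
  have "{I \<in> left_principal_ideals. ?A \<subseteq> I \<and> I \<subseteq> ?B} =
        insert ?A {I \<in> left_principal_ideals. ?A \<subset> I \<and> I \<subseteq> ?B}"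
    using less by (auto simp: left_principal_ideals_def)
  then have "(\<Sum>I \<in> {I \<in> left_principal_ideals. ?A \<subseteq> I \<and> I \<subseteq> ?B}. lpi_moebius I ?B) =
             lpi_moebius ?A ?B +
             (\<Sum>I \<in> {I \<in> left_principal_ideals. ?A \<subset> I \<and> I \<subseteq> ?B}. lpi_moebius I ?B)"
    by simp
  also have "lpi_moebius ?A ?B =
             - (\<Sum>I \<in> {I \<in> left_principal_ideals. ?A \<subset> I \<and> I \<subseteq> ?B}. lpi_moebius I ?B)"
    using less by (subst lpi_moebius.simps) auto
  finally show "(\<Sum>I \<in> {I \<in> left_principal_ideals. ?A \<subseteq> I \<and> I \<subseteq> ?B}. lpi_moebius I ?B) = 0"
    by simp
qed

definition ring_units :: "'a::ring_1 set" where
  "ring_units = {u. \<exists>v. u * v = 1 \<and> v * u = 1}"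

definition hom_weight :: "real \<Rightarrow> 'a::{ring_1,finite} \<Rightarrow> real" where
  "hom_weight \<gamma> x =
     \<gamma> * (1 - real_of_int (lpi_moebius {0} (left_principal_ideal x)) /
              real (card {u * x | u. u \<in> ring_units}))"

definition vec_weight :: "real \<Rightarrow> 'a::{ring_1,finite} vec \<Rightarrow> real" where
  "vec_weight \<gamma> c = (\<Sum>i<dim_vec c. hom_weight \<gamma> (c $ i))"

section \<open>Codes\<close>

definition left_linear_code :: "nat \<Rightarrow> 'a::ring_1 vec set \<Rightarrow> bool" where
  "left_linear_code n C \<longleftrightarrow>
     C \<subseteq> carrier_vec n \<and> 0\<^sub>v n \<in> C \<and>
     (\<forall>c\<in>C. \<forall>c'\<in>C. c + c' \<in> C) \<and> (\<forall>r. \<forall>c\<in>C. r \<cdot>\<^sub>v c \<in> C)"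

text \<open>Row vector times matrix: $xY$, with the entries of $x$ on the left.\<close>

definition row_mult :: "'a::ring_1 vec \<Rightarrow> 'a mat \<Rightarrow> 'a vec" where
  "row_mult x Y = vec (dim_col Y) (\<lambda>j. x \<bullet> col Y j)"

definition generator_matrix :: "nat \<Rightarrow> nat \<Rightarrow> 'a::ring_1 vec set \<Rightarrow> 'a mat \<Rightarrow> bool" where
  "generator_matrix l n C Y \<longleftrightarrow>
     Y \<in> carrier_mat l n \<and> C = {row_mult x Y | x. x \<in> carrier_vec l}"

definition proper_code :: "real \<Rightarrow> nat \<Rightarrow> 'a::{ring_1,finite} vec set \<Rightarrow> bool" where
  "proper_code \<gamma> n C \<longleftrightarrow> (\<forall>c\<in>C. vec_weight \<gamma> c = 0 \<longrightarrow> c = 0\<^sub>v n)"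

definition regular_matrix :: "'a::ring_1 mat \<Rightarrow> bool" where
  "regular_matrix Y \<longleftrightarrow>
     (\<forall>i<dim_col Y. {x \<bullet> col Y i | x. x \<in> carrier_vec (dim_row Y)} = UNIV)"

text \<open>$yR$ for a column $y$: the entries of $y$ are multiplied from the right.\<close>

definition right_span :: "'a::ring_1 vec \<Rightarrow> 'a vec set" where
  "right_span y = {map_vec (\<lambda>a. a * r) y | r. True}"

definition projective_matrix :: "'a::ring_1 mat \<Rightarrow> bool" where
  "projective_matrix Y \<longleftrightarrow>
     (\<forall>i<dim_col Y. \<forall>j<dim_col Y. i \<noteq> j \<longrightarrow> right_span (col Y i) \<noteq> right_span (col Y j))"

text \<open>A code is regular (projective) if its generator matrices are. The choice of the matrix
  is irrelevant by \<open>regular_code_iff\<close> and \<open>projective_code_iff\<close> below.\<close>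

definition regular_code :: "nat \<Rightarrow> 'a::ring_1 vec set \<Rightarrow> bool" where
  "regular_code n C \<longleftrightarrow> (\<exists>l Y. generator_matrix l n C Y \<and> regular_matrix Y)"

definition projective_code :: "nat \<Rightarrow> 'a::ring_1 vec set \<Rightarrow> bool" where
  "projective_code n C \<longleftrightarrow> (\<exists>l Y. generator_matrix l n C Y \<and> projective_matrix Y)"

lemma regular_matrix_iff:
  assumes "generator_matrix l n C Y"
  shows "regular_matrix Y \<longleftrightarrow> (\<forall>i<n. (\<lambda>c. c $ i) ` C = UNIV)"
proof -
  have dims: "dim_row Y = l" "dim_col Y = n" and C: "C = {row_mult x Y | x. x \<in> carrier_vec l}"
    using assms by (auto simp: generator_matrix_def)
  have "(\<lambda>c. c $ i) ` C = {x \<bullet> col Y i | x. x \<in> carrier_vec (dim_row Y)}" if "i < n" for i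
    using that unfolding C by (force simp: row_mult_def dims)
  then show ?thesis
    by (simp add: regular_matrix_def dims)
qed

lemma right_span_subset_iff:
  fixes y z :: "'a::ring_1 vec"
  shows "right_span z \<subseteq> right_span y \<longleftrightarrow> (\<exists>r. z = map_vec (\<lambda>a. a * r) y)"
proof
  assume "right_span z \<subseteq> right_span y"
  moreover have "z \<in> right_span z"
    by (auto simp: right_span_def intro!: exI[of _ 1])
  ultimately show "\<exists>r. z = map_vec (\<lambda>a. a * r) y"
    by (auto simp: right_span_def)
next
  assume "\<exists>r. z = map_vec (\<lambda>a. a * r) y"
  then obtain r where "z = map_vec (\<lambda>a. a * r) y" ..
  then have "map_vec (\<lambda>a. a * s) z = map_vec (\<lambda>a. a * (r * s)) y" for s
    by (auto simp: mult.assoc)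
  then show "right_span z \<subseteq> right_span y"
    by (auto simp: right_span_def)
qed

lemma right_span_col_subset_iff:
  assumes "generator_matrix l n C Y" and "i < n" "j < n"
  shows "right_span (col Y j) \<subseteq> right_span (col Y i) \<longleftrightarrow> (\<exists>r. \<forall>c\<in>C. c $ j = c $ i * r)"
proof -
  have dims: "dim_row Y = l" "dim_col Y = n" and C: "C = {row_mult x Y | x. x \<in> carrier_vec l}"
    using assms by (auto simp: generator_matrix_def)
  have "col Y j = map_vec (\<lambda>a. a * r) (col Y i) \<longleftrightarrow> (\<forall>c\<in>C. c $ j = c $ i * r)" for r
  proof
    assume eq: "col Y j = map_vec (\<lambda>a. a * r) (col Y i)"
    have "x \<bullet> col Y j = (x \<bullet> col Y i) * r" for x
      unfolding eq
      by (auto simp: scalar_prod_def sum_distrib_right mult.assoc intro!: sum.cong)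
    then show "\<forall>c\<in>C. c $ j = c $ i * r"
      using assms(2,3) by (auto simp: C row_mult_def dims)
  next
    assume *: "\<forall>c\<in>C. c $ j = c $ i * r"
    show "col Y j = map_vec (\<lambda>a. a * r) (col Y i)"
    proof (rule eq_vecI)
      fix k assume "k < dim_vec (map_vec (\<lambda>a. a * r) (col Y i))"
      then have k: "k < l" by (simp add: dims)
      have "row_mult (unit_vec l k) Y \<in> C"
        by (auto simp: C)
      with * have "row_mult (unit_vec l k) Y $ j = row_mult (unit_vec l k) Y $ i * r"
        by blast
      moreover have "row_mult (unit_vec l k) Y $ m = col Y m $ k" if "m < n" for m
      proof -
        have "row_mult (unit_vec l k) Y $ m = unit_vec l k \<bullet> col Y m"
          unfolding row_mult_def by (rule index_vec) (simp only: dims that)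
        also have "\<dots> = col Y m $ k"
          by (rule scalar_prod_left_unit[OF _ k]) (rule carrier_vecI, simp only: dim_col dims)
        finally show ?thesis .
      qed
      ultimately show "col Y j $ k = map_vec (\<lambda>a. a * r) (col Y i) $ k"
        using assms(2,3) k by (simp add: dims)
    qed (simp add: dims)
  qed
  then show ?thesis
    by (simp add: right_span_subset_iff)
qed

lemma regular_code_iff:
  assumes "generator_matrix l n C Y"
  shows "regular_code n C \<longleftrightarrow> regular_matrix Y"
proof -
  have "regular_matrix Z \<longleftrightarrow> regular_matrix Y" if "generator_matrix m n C Z" for m Z
    using regular_matrix_iff[OF that] regular_matrix_iff[OF assms] by simp
  with assms show ?thesis
    unfolding regular_code_def by blast
qed

lemma projective_code_iff:
  assumes "generator_matrix l n C Y"
  shows "projective_code n C \<longleftrightarrow> projective_matrix Y"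
proof -
  have char: "projective_matrix Z \<longleftrightarrow>
          (\<forall>i<n. \<forall>j<n. i \<noteq> j \<longrightarrow>
             \<not> ((\<exists>r. \<forall>c\<in>C. c $ j = c $ i * r) \<and> (\<exists>r. \<forall>c\<in>C. c $ i = c $ j * r)))"
    if Z: "generator_matrix m n C Z" for m Z
  proof -
    have dim: "dim_col Z = n" using Z by (auto simp: generator_matrix_def)
    have "right_span (col Z i) = right_span (col Z j) \<longleftrightarrow>
            (\<exists>r. \<forall>c\<in>C. c $ j = c $ i * r) \<and> (\<exists>r. \<forall>c\<in>C. c $ i = c $ j * r)"
      if "i < n" "j < n" for i j
      using right_span_col_subset_iff[OF Z that] right_span_col_subset_iff[OF Z that(2,1)]
      by blast
    then show ?thesis
      by (simp add: projective_matrix_def dim)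
  qed
  have "projective_matrix Z \<longleftrightarrow> projective_matrix Y" if "generator_matrix m n C Z" for m Z
    by (rule trans[OF char[OF that] char[OF assms, symmetric]])
  note indep = this
  show ?thesis
  proof
    assume "projective_code n C"
    then obtain m Z where "generator_matrix m n C Z" "projective_matrix Z"
      unfolding projective_code_def by (elim exE conjE)
    then show "projective_matrix Y"
      by (simp only: indep)
  next
    assume "projective_matrix Y"
    with assms show "projective_code n C"
      unfolding projective_code_def by (intro exI conjI)
  qed
qed

definition two_weight_code ::
    "real \<Rightarrow> 'a::{ring_1,finite} vec set \<Rightarrow> real \<Rightarrow> real \<Rightarrow> bool" where
  "two_weight_code \<gamma> C w\<^sub>1 w\<^sub>2 \<longleftrightarrow> w\<^sub>1 < w\<^sub>2 \<and> vec_weight \<gamma> ` C - {0} = {w\<^sub>1, w\<^sub>2}"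

end

theory Submission
  imports Defs "Jordan_Normal_Form.Char_Poly"
begin

text \<open>
  The Frobenius property provides a generating character \<open>\<chi>\<close> of the ring \<open>R\<close>. Let \<open>U\<close> be the group
  of units of \<open>R\<close>. For the normalisation \<open>\<gamma> = |U|\<close> the homogeneous weight is
  \<open>w(x) = |U| - (\<Sum>u\<in>U. \<chi> (x * u))\<close>
  (\<open>hom_weight_eq_unit_sum\<close>). Hence the weight of a codeword \<open>c\<close> is \<open>|J| - F(c)\<close>, where \<open>F\<close> is
  the sum of the characters \<open>c \<mapsto> \<chi> (c\<^sub>i * u)\<close> of the additive group of \<open>C\<close>, indexed by the set
  \<open>J\<close> of all pairs of a position \<open>i\<close> and a unit \<open>u\<close>. Regularity makes these
  characters nontrivial, and together with projectivity it makes them pairwise different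
  (\<open>coordinate_characters_distinct\<close>).

  The rest is the duality theory of Delsarte on a finite group (\<open>two_valued_character_sum\<close>). Let
  \<open>A\<close> be the set of codewords of weight \<open>w\<^sub>1\<close>; by properness all other nonzero codewords have weight
  \<open>w\<^sub>2\<close>. For a nontrivial character \<open>\<theta>\<close> of \<open>C\<close> put \<open>E = (\<Sum>c\<in>A. \<theta> c)\<close>. Pairing \<open>F\<close> with \<open>\<theta>\<close>
  and using orthogonality of characters gives
  \<open>(w\<^sub>2 - w\<^sub>1) * E = m * |C| - w\<^sub>2\<close>, where \<open>m\<close> is the number of characters in the family that are
  inverse to \<open>\<theta>\<close>, so \<open>m\<close> is 0 or 1. Thus \<open>E\<close> is rational. It is also an eigenvalue of an integer
  matrix, namely of the adjacency matrix of the Cayley graph with connection set \<open>A\<close>, and therefore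
  an integer. So \<open>w\<^sub>2 - w\<^sub>1\<close> divides \<open>m * |C| - w\<^sub>2\<close>. Both values of \<open>m\<close> occur: \<open>m = 1\<close>
  for the inverse of a member of the family, and \<open>m = 0\<close> for some \<open>\<theta>\<close> because a family
  consisting of all nontrivial characters would give only one weight
  (\<open>nontrivial_character_outside\<close>). With \<open>m = 0\<close> the difference \<open>d = w\<^sub>2 - w\<^sub>1\<close> divides \<open>w\<^sub>2\<close>, with
  \<open>m = 1\<close> it then divides \<open>|C|\<close>, and \<open>t = w\<^sub>1 / d\<close>.

  Two facts on finite rings enter the formula for the weight. Generators of the same principal left
  ideal differ by a unit on the left (\<open>left_principal_ideal_eq_iff_associated\<close>), so that the
  orbit \<open>U x\<close> in the definition of the weight is the set of generators of \<open>R x\<close>, over which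
  Moebius inversion evaluates the sum of \<open>\<chi>\<close>. This produces the sum of \<open>\<chi> (u * x)\<close> over the units, while
  projectivity, which concerns right multiples of columns, separates the characters formed
  with \<open>\<chi> (x * u)\<close>; the two sums agree because left and right generating characters are the same
  (\<open>sum_over_units_commute\<close>).
\<close>

section \<open>Characters of finite groups\<close>

lemma sum_eq_0_if_scaled_by_permutation:
  fixes f :: "'b \<Rightarrow> 'c::idom"
  assumes "bij_betw \<tau> A A" and "\<And>x. x \<in> A \<Longrightarrow> f (\<tau> x) = k * f x" and "k \<noteq> 1"
  shows "sum f A = 0"
proof -
  have "sum f A = (\<Sum>x\<in>A. f (\<tau> x))"
    using sum.reindex_bij_betw[OF assms(1), of f] by simp
  also have "\<dots> = k * sum f A"
    using assms(2) by (simp add: sum_distrib_left)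
  finally have "(1 - k) * sum f A = 0"
    by (simp add: algebra_simps)
  with \<open>k \<noteq> 1\<close> show ?thesis by simp
qed

text \<open>The eigenvalue is a root of the characteristic polynomial, which is monic with integer coefficients.\<close>

lemma algebraic_int_eigenvalue_of_int_mat:
  fixes A :: "int mat" and k :: complex
  assumes A: "A \<in> carrier_mat n n" and k: "eigenvalue (map_mat of_int A) k"
  shows "algebraic_int k"
proof -
  have "poly (char_poly (map_mat of_int A)) k = 0"
    using k eigenvalue_root_char_poly[of "map_mat of_int A" n k] A by simp
  then have "poly (map_poly of_int (char_poly A)) k = 0"
    unfolding of_int_hom.char_poly_hom[OF A] .
  moreover have "lead_coeff (char_poly A) = 1"
    using degree_monic_char_poly[OF A] by simp
  ultimately show ?thesis
    unfolding algebraic_int_altdef_ipoly by blast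
qed

definition character_on :: "('g, 'm) monoid_scheme \<Rightarrow> ('g \<Rightarrow> complex) \<Rightarrow> bool" where
  "character_on G \<psi> \<longleftrightarrow>
     (\<forall>x\<in>carrier G. \<psi> x \<noteq> 0) \<and>
     (\<forall>x\<in>carrier G. \<forall>y\<in>carrier G. \<psi> (x \<otimes>\<^bsub>G\<^esub> y) = \<psi> x * \<psi> y)"

lemma character_on_mult:
  "character_on G \<psi> \<Longrightarrow> character_on G \<theta> \<Longrightarrow> character_on G (\<lambda>g. \<psi> g * \<theta> g)"
  by (simp add: character_on_def)

lemma character_on_inverse:
  "character_on G \<psi> \<Longrightarrow> character_on G (\<lambda>g. inverse (\<psi> g))"
  by (simp add: character_on_def)

context group
begin

lemma character_one:
  assumes "character_on G \<psi>" shows "\<psi> \<one> = 1"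
proof -
  have "\<psi> \<one> * \<psi> \<one> = \<psi> \<one> * 1" "\<psi> \<one> \<noteq> 0"
    using assms by (auto simp: character_on_def dest!: bspec[of _ _ \<one>])
  then show ?thesis by (metis mult_cancel_left)
qed

lemma bij_betw_left_translation:
  assumes "g \<in> carrier G" shows "bij_betw (\<lambda>x. g \<otimes> x) (carrier G) (carrier G)"
  using assms by (simp add: bij_betw_def inj_on_cmult surj_const_mult)

lemma sum_nontrivial_character:
  assumes "character_on G \<psi>" and "g \<in> carrier G" and "\<psi> g \<noteq> 1"
  shows "(\<Sum>x\<in>carrier G. \<psi> x) = 0"
  by (rule sum_eq_0_if_scaled_by_permutation[OF bij_betw_left_translation[OF assms(2)] _ assms(3)])
    (use assms in \<open>auto simp: character_on_def\<close>)

text \<open>Otherwise translation by \<open>x\<close> would scale the sum of the positive numbers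
  \<open>norm (\<psi> g)\<close> by a factor different from 1, and that sum would vanish.\<close>

lemma norm_character:
  assumes "character_on G \<psi>" and "x \<in> carrier G" and "finite (carrier G)"
  shows "norm (\<psi> x) = 1"
proof (rule ccontr)
  assume "norm (\<psi> x) \<noteq> 1"
  then have "(\<Sum>g\<in>carrier G. norm (\<psi> g)) = 0"
    by (rule sum_eq_0_if_scaled_by_permutation[OF bij_betw_left_translation[OF assms(2)], rotated])
      (use assms in \<open>auto simp: character_on_def norm_mult\<close>)
  moreover have "(\<Sum>g\<in>carrier G. norm (\<psi> g)) > 0"
    using assms by (intro sum_pos) (auto simp: character_on_def)
  ultimately show False by simp
qed

text \<open>The sum is an eigenvalue of the adjacency matrix of the Cayley graph in which
  \<open>g\<close> is joined to \<open>g \<otimes> s\<close> for \<open>s \<in> S\<close>, and \<open>\<psi>\<close> is an eigenvector.\<close>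

lemma algebraic_int_character_sum:
  assumes fin: "finite (carrier G)" and \<psi>: "character_on G \<psi>" and S: "S \<subseteq> carrier G"
  shows "algebraic_int (\<Sum>s\<in>S. \<psi> s)"
proof -
  obtain e where e: "bij_betw e {0..<card (carrier G)} (carrier G)"
    using ex_bij_betw_nat_finite[OF fin] by auto
  have e_in: "e i \<in> carrier G" if "i < card (carrier G)" for i
    using bij_betwE[OF e] that by auto
  define A :: "int mat"
    where "A = mat (card (carrier G)) (card (carrier G)) (\<lambda>(i, j). of_bool (inv (e i) \<otimes> e j \<in> S))"
  define v where "v = vec (card (carrier G)) (\<lambda>j. \<psi> (e j))"
  have row: "(\<Sum>j = 0..<card (carrier G). of_bool (inv (e i) \<otimes> e j \<in> S) * \<psi> (e j)) = (\<Sum>s\<in>S. \<psi> s) * \<psi> (e i)"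
    if "i < card (carrier G)" for i
  proof -
    have "(\<Sum>j = 0..<card (carrier G). of_bool (inv (e i) \<otimes> e j \<in> S) * \<psi> (e j)) =
          (\<Sum>g\<in>carrier G. of_bool (inv (e i) \<otimes> g \<in> S) * \<psi> g)"
      by (rule sum.reindex_bij_betw[OF e])
    also have "\<dots> = (\<Sum>g\<in>carrier G. of_bool (inv (e i) \<otimes> (e i \<otimes> g) \<in> S) * \<psi> (e i \<otimes> g))"
      by (rule sum.reindex_bij_betw[OF bij_betw_left_translation[OF e_in[OF that]], symmetric])
    also have "\<dots> = (\<Sum>g\<in>carrier G. of_bool (g \<in> S) * (\<psi> (e i) * \<psi> g))"
      using e_in[OF that] \<psi> by (intro sum.cong) (auto simp: m_assoc[symmetric] character_on_def)
    also have "\<dots> = (\<Sum>g\<in>S. \<psi> (e i) * \<psi> g)"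
      using S fin by (intro sum.mono_neutral_cong_right) auto
    finally show ?thesis
      by (simp add: sum_distrib_left sum_distrib_right mult.commute)
  qed
  have "eigenvector (map_mat of_int A) v (\<Sum>s\<in>S. \<psi> s)"
    unfolding eigenvector_def
  proof (intro conjI)
    have "card (carrier G) > 0" using fin by (auto simp: card_gt_0_iff)
    moreover from this have "v $ 0 \<noteq> 0"
      using \<psi> e_in[of 0] by (simp add: v_def character_on_def)
    ultimately show "v \<noteq> 0\<^sub>v (dim_row (map_mat of_int A))"
      by (auto simp: A_def)
    show "map_mat of_int A *\<^sub>v v = (\<Sum>s\<in>S. \<psi> s) \<cdot>\<^sub>v v"
    proof (rule eq_vecI)
      fix i assume "i < dim_vec ((\<Sum>s\<in>S. \<psi> s) \<cdot>\<^sub>v v)"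
      then have i: "i < card (carrier G)" by (simp add: v_def)
      have "(map_mat of_int A *\<^sub>v v) $ i =
            (\<Sum>j = 0..<card (carrier G). of_bool (inv (e i) \<otimes> e j \<in> S) * \<psi> (e j))"
        using i by (auto simp: A_def v_def scalar_prod_def intro!: sum.cong)
      with row[OF i] i show "(map_mat of_int A *\<^sub>v v) $ i = ((\<Sum>s\<in>S. \<psi> s) \<cdot>\<^sub>v v) $ i"
        by (simp add: v_def)
    qed (simp add: A_def v_def)
  qed (simp add: A_def v_def)
  then show ?thesis
    by (intro algebraic_int_eigenvalue_of_int_mat[of A "card (carrier G)"]) (auto simp: eigenvalue_def A_def)
qed

text \<open>The function \<open>W\<close> measures how far the sum of the characters falls short of its value at the
  neutral element. Its pairing with \<open>\<theta>\<close> can be computed in two ways. Orthogonality of characters gives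
  \<open>- m * |G|\<close>, where \<open>m\<close> counts the characters \<open>\<psi> j\<close> inverse to \<open>\<theta>\<close>. Splitting \<open>G\<close> into the
  level sets of \<open>W\<close> gives \<open>- w2 - (w2 - w1) * E\<close>, where \<open>E\<close> is the sum of \<open>\<theta>\<close> over the elements
  of value \<open>w1\<close>. Hence \<open>E\<close> is rational, and being an algebraic integer it is an integer.\<close>

lemma two_valued_defect_dvd:
  fixes W :: "'a \<Rightarrow> int" and \<psi> :: "'j \<Rightarrow> 'a \<Rightarrow> complex"
  assumes fin: "finite (carrier G)" and finJ: "finite J"
    and chars: "\<And>j. j \<in> J \<Longrightarrow> character_on G (\<psi> j)"
    and W: "\<And>g. g \<in> carrier G \<Longrightarrow> of_int (W g) = of_nat (card J) - (\<Sum>j\<in>J. \<psi> j g)"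
    and weights: "\<And>g. g \<in> carrier G - {\<one>} \<Longrightarrow> W g = w1 \<or> W g = w2" and "w1 \<noteq> w2"
    and \<theta>: "character_on G \<theta>" and h: "h \<in> carrier G" "\<theta> h \<noteq> 1"
  shows "w2 - w1 dvd int (card {j \<in> J. \<forall>g\<in>carrier G. \<psi> j g * \<theta> g = 1} * card (carrier G)) - w2"
proof -
  let ?M = "{j \<in> J. \<forall>g\<in>carrier G. \<psi> j g * \<theta> g = 1}"
  define A where "A = {g \<in> carrier G - {\<one>}. W g = w1}"
  define E where "E = (\<Sum>g\<in>A. \<theta> g)"
  have \<theta>_sum: "(\<Sum>g\<in>carrier G. \<theta> g) = 0"
    by (rule sum_nontrivial_character[OF \<theta> h])
  have dual_term: "(\<Sum>g\<in>carrier G. \<psi> j g * \<theta> g) = (if j \<in> ?M then of_nat (card (carrier G)) else 0)"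
    if "j \<in> J" for j
  proof (cases "j \<in> ?M")
    case True
    then show ?thesis by simp
  next
    case False
    then obtain g where "g \<in> carrier G" "\<psi> j g * \<theta> g \<noteq> 1" using \<open>j \<in> J\<close> by auto
    with sum_nontrivial_character[OF character_on_mult[OF chars[OF \<open>j \<in> J\<close>] \<theta>]] False
    show ?thesis by auto
  qed
  have "(\<Sum>g\<in>carrier G. of_int (W g) * \<theta> g) =
        of_nat (card J) * (\<Sum>g\<in>carrier G. \<theta> g) - (\<Sum>g\<in>carrier G. (\<Sum>j\<in>J. \<psi> j g * \<theta> g))"
    by (simp add: W algebra_simps sum_subtractf sum_distrib_left sum_distrib_right)
  also have "(\<Sum>g\<in>carrier G. (\<Sum>j\<in>J. \<psi> j g * \<theta> g)) = (\<Sum>j\<in>J. \<Sum>g\<in>carrier G. \<psi> j g * \<theta> g)"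
    by (rule sum.swap)
  also have "\<dots> = (\<Sum>j\<in>J. if j \<in> ?M then of_nat (card (carrier G)) else 0)"
    by (rule sum.cong) (auto simp: dual_term)
  also have "\<dots> = of_nat (card ?M * card (carrier G))"
    using finJ by (simp add: sum.If_cases Int_def)
  finally have dual: "(\<Sum>g\<in>carrier G. of_int (W g) * \<theta> g) = - of_nat (card ?M * card (carrier G))"
    by (simp add: \<theta>_sum)
  have W1: "W \<one> = 0"
    using W[of \<one>] character_one[OF chars] by simp
  \<comment> \<open>\<open>W\<close> is the constant \<open>w2\<close>, corrected on \<open>A\<close> and at the neutral element, where \<open>W\<close> vanishes.\<close>
  have "(\<Sum>g\<in>carrier G. of_int (W g) * \<theta> g) =
        (\<Sum>g\<in>carrier G. of_int w2 * \<theta> g - (if g \<in> A then of_int (w2 - w1) * \<theta> g else 0)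
           - (if g = \<one> then of_int w2 * \<theta> g else 0))"
    using weights W1 by (intro sum.cong) (auto simp: A_def algebra_simps)
  also have "\<dots> = of_int w2 * (\<Sum>g\<in>carrier G. \<theta> g) - of_int (w2 - w1) * E - of_int w2"
  proof -
    have "carrier G \<inter> A = A" by (auto simp: A_def)
    then show ?thesis
      using fin character_one[OF \<theta>]
      by (simp add: sum_subtractf sum_distrib_left E_def sum.inter_restrict[symmetric])
  qed
  finally have "of_int (w2 - w1) * E = of_nat (card ?M * card (carrier G)) - of_int w2"
    using dual \<theta>_sum by (simp add: algebra_simps)
  then have E: "of_int (w2 - w1) * E = of_int (int (card ?M * card (carrier G)) - w2)"
    by simp
  then have "E = of_int (int (card ?M * card (carrier G)) - w2) / of_int (w2 - w1)"
    using \<open>w1 \<noteq> w2\<close> by (simp add: field_simps)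
  then have "E \<in> \<rat>" by simp
  moreover have "algebraic_int E"
    unfolding E_def by (rule algebraic_int_character_sum[OF fin \<theta>]) (auto simp: A_def)
  ultimately have "E \<in> \<int>" by (rule rational_algebraic_int_is_int[rotated])
  then obtain k where "E = of_int k" by (rule Ints_cases)
  with E have "of_int ((w2 - w1) * k) = (of_int (int (card ?M * card (carrier G)) - w2) :: complex)"
    by simp
  then have "(w2 - w1) * k = int (card ?M * card (carrier G)) - w2"
    unfolding of_int_eq_iff .
  then show ?thesis by (metis dvd_triv_left)
qed

text \<open>If the family contained every nontrivial character, then adding the trivial one would make it
  closed under multiplication by each member. This would force the total \<open>1 + (\<Sum>j\<in>J. \<psi> j x)\<close> to
  vanish at every \<open>x\<close> at which some member differs from 1.\<close>

lemma nontrivial_character_outside: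
  fixes \<psi> :: "'j \<Rightarrow> 'a \<Rightarrow> complex"
  assumes finJ: "finite J"
    and chars: "\<And>j. j \<in> J \<Longrightarrow> character_on G (\<psi> j)"
    and nontrivial: "\<And>j. j \<in> J \<Longrightarrow> \<exists>g\<in>carrier G. \<psi> j g \<noteq> 1"
    and distinct: "\<And>i j. i \<in> J \<Longrightarrow> j \<in> J \<Longrightarrow> i \<noteq> j \<Longrightarrow> \<exists>g\<in>carrier G. \<psi> i g \<noteq> \<psi> j g"
    and x: "x \<in> carrier G" "(\<Sum>j\<in>J. \<psi> j x) \<noteq> of_nat (card J)" "(\<Sum>j\<in>J. \<psi> j x) \<noteq> -1"
  shows "\<exists>\<theta>. character_on G \<theta> \<and> (\<exists>h\<in>carrier G. \<theta> h \<noteq> 1) \<and>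
           (\<forall>j\<in>J. \<exists>g\<in>carrier G. \<psi> j g \<noteq> \<theta> g)"
proof (rule ccontr)
  assume contra: "\<not> ?thesis"
  \<comment> \<open>The index \<open>None\<close> stands for the trivial character.\<close>
  define J' where "J' = insert None (Some ` J)"
  define \<psi>' where "\<psi>' = (\<lambda>k. case k of None \<Rightarrow> (\<lambda>_. 1) | Some j \<Rightarrow> \<psi> j)"
  have chars': "character_on G (\<psi>' k)" if "k \<in> J'" for k
    using that chars by (auto simp: J'_def \<psi>'_def character_on_def)
  have all: "\<exists>k\<in>J'. \<forall>g\<in>carrier G. \<psi>' k g = \<theta> g" if "character_on G \<theta>" for \<theta>
  proof (cases "\<exists>h\<in>carrier G. \<theta> h \<noteq> 1")
    case True
    then have "\<exists>j\<in>J. \<forall>g\<in>carrier G. \<psi> j g = \<theta> g"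
      using contra that by blast
    then show ?thesis by (auto simp: J'_def \<psi>'_def)
  next
    case False
    then show ?thesis by (auto simp: J'_def \<psi>'_def)
  qed
  have distinct': "k = l" if "k \<in> J'" "l \<in> J'" "\<And>g. g \<in> carrier G \<Longrightarrow> \<psi>' k g = \<psi>' l g" for k l
  proof (rule ccontr)
    assume "k \<noteq> l"
    then have "\<exists>g\<in>carrier G. \<psi>' k g \<noteq> \<psi>' l g"
      using that(1,2) distinct nontrivial
      by (cases k; cases l) (auto simp: J'_def \<psi>'_def eq_commute[of 1])
    with that(3) show False by blast
  qed
  have "\<exists>j\<in>J. \<psi> j x \<noteq> 1"
  proof (rule ccontr)
    assume "\<not> (\<exists>j\<in>J. \<psi> j x \<noteq> 1)"
    then have "(\<Sum>j\<in>J. \<psi> j x) = (\<Sum>j\<in>J. 1)" by (intro sum.cong) auto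
    with x(2) show False by simp
  qed
  then obtain i where i: "i \<in> J" "\<psi> i x \<noteq> 1" by blast
  \<comment> \<open>Multiplication by \<open>\<psi> i\<close> permutes the enlarged family.\<close>
  have "\<forall>k\<in>J'. \<exists>k'. k' \<in> J' \<and> (\<forall>g\<in>carrier G. \<psi>' k' g = \<psi> i g * \<psi>' k g)"
    using all[OF character_on_mult[OF chars[OF i(1)] chars']] by blast
  then obtain \<tau> where \<tau>: "\<And>k. k \<in> J' \<Longrightarrow> \<tau> k \<in> J'"
    "\<And>k g. k \<in> J' \<Longrightarrow> g \<in> carrier G \<Longrightarrow> \<psi>' (\<tau> k) g = \<psi> i g * \<psi>' k g"
    by (metis (no_types))
  have "inj_on \<tau> J'"
  proof (rule inj_onI)
    fix k l assume kl: "k \<in> J'" "l \<in> J'" "\<tau> k = \<tau> l"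
    show "k = l"
    proof (rule distinct'[OF kl(1,2)])
      fix g assume g: "g \<in> carrier G"
      then have "\<psi> i g * \<psi>' k g = \<psi> i g * \<psi>' l g"
        using \<tau>(2) kl by metis
      moreover have "\<psi> i g \<noteq> 0" using chars[OF i(1)] g by (auto simp: character_on_def)
      ultimately show "\<psi>' k g = \<psi>' l g" by simp
    qed
  qed
  moreover have "finite J'" using finJ by (simp add: J'_def)
  ultimately have "bij_betw \<tau> J' J'"
    using \<tau>(1) by (simp add: bij_betw_def endo_inj_surj image_subsetI)
  then have "(\<Sum>k\<in>J'. \<psi>' k x) = 0"
    using \<tau>(2) x(1) i(2) by (intro sum_eq_0_if_scaled_by_permutation) auto
  then have "1 + (\<Sum>j\<in>J. \<psi> j x) = 0"
    using finJ by (simp add: J'_def \<psi>'_def sum.reindex)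
  with x(3) show False by (simp add: add_eq_0_iff)
qed

text \<open>In the language of codes: \<open>G\<close> is the code and \<open>W\<close> its weight. The lemma \<open>two_valued_defect_dvd\<close> is
  applied to the inverse of a nontrivial character outside the family and to the inverse of a member,
  for which the number of matching indices is 0 and 1 respectively.\<close>

theorem two_valued_character_sum:
  fixes W :: "'a \<Rightarrow> int" and \<psi> :: "'j \<Rightarrow> 'a \<Rightarrow> complex"
  assumes fin: "finite (carrier G)" and finJ: "finite J"
    and chars: "\<And>j. j \<in> J \<Longrightarrow> character_on G (\<psi> j)"
    and nontrivial: "\<And>j. j \<in> J \<Longrightarrow> \<exists>g\<in>carrier G. \<psi> j g \<noteq> 1"
    and distinct: "\<And>i j. i \<in> J \<Longrightarrow> j \<in> J \<Longrightarrow> i \<noteq> j \<Longrightarrow> \<exists>g\<in>carrier G. \<psi> i g \<noteq> \<psi> j g"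
    and W: "\<And>g. g \<in> carrier G \<Longrightarrow> of_int (W g) = of_nat (card J) - (\<Sum>j\<in>J. \<psi> j g)"
    and weights: "W ` (carrier G - {\<one>}) = {w1, w2}"
    and w: "w1 \<noteq> 0" "w1 < w2"
  shows "0 < w1 \<and> w2 - w1 dvd int (card (carrier G)) \<and> w2 - w1 dvd w2"
proof -
  have "w1 \<in> W ` (carrier G - {\<one>})" "w2 \<in> W ` (carrier G - {\<one>})"
    using weights by simp_all
  then obtain g1 g2 where g1: "g1 \<in> carrier G" "W g1 = w1" and g2: "g2 \<in> carrier G" "W g2 = w2"
    by blast
  \<comment> \<open>Characters have absolute value 1, so their sum is at most \<open>card J\<close> in absolute value and \<open>W\<close> is nonnegative.\<close>
  have "norm (\<Sum>j\<in>J. \<psi> j g1) \<le> of_nat (card J)"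
    using norm_sum[of "\<lambda>j. \<psi> j g1" J] norm_character[OF chars g1(1) fin] by simp
  moreover have "(\<Sum>j\<in>J. \<psi> j g1) = of_real (real (card J) - real_of_int w1)"
    using W[OF g1(1)] g1(2) by simp
  ultimately have "\<bar>real (card J) - real_of_int w1\<bar> \<le> real (card J)"
    by (simp only: norm_of_real)
  then have "0 < w1" using w(1) by linarith
  have in_values: "W g = w1 \<or> W g = w2" if "g \<in> carrier G - {\<one>}" for g
    using weights that by blast
  \<comment> \<open>The value \<open>card J + 1\<close> of \<open>W\<close> corresponds to the character sum -1, and only one of \<open>w1\<close>, \<open>w2\<close> can equal it.\<close>
  obtain x where x: "x \<in> carrier G" "W x \<noteq> 0" "W x \<noteq> int (card J) + 1"
    using g1 g2 w \<open>0 < w1\<close> by (cases "w1 = int (card J) + 1") auto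
  have F: "(\<Sum>j\<in>J. \<psi> j x) = of_int (int (card J) - W x)"
    using W[OF x(1)] by simp
  have "(\<Sum>j\<in>J. \<psi> j x) \<noteq> of_int (int (card J))" "(\<Sum>j\<in>J. \<psi> j x) \<noteq> of_int (-1)"
    unfolding F of_int_eq_iff using x by auto
  then have F_ne: "(\<Sum>j\<in>J. \<psi> j x) \<noteq> of_nat (card J)" "(\<Sum>j\<in>J. \<psi> j x) \<noteq> -1"
    by simp_all
  have "\<exists>\<theta>. character_on G \<theta> \<and> (\<exists>h\<in>carrier G. \<theta> h \<noteq> 1) \<and>
          (\<forall>j\<in>J. \<exists>g\<in>carrier G. \<psi> j g \<noteq> \<theta> g)"
    by (rule nontrivial_character_outside[OF finJ chars nontrivial distinct x(1) F_ne])
  then obtain \<theta> h where \<theta>: "character_on G \<theta>" "h \<in> carrier G" "\<theta> h \<noteq> 1"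
    "\<forall>j\<in>J. \<exists>g\<in>carrier G. \<psi> j g \<noteq> \<theta> g" by blast
  have nz: "\<theta> g \<noteq> 0" if "g \<in> carrier G" for g
    using \<theta>(1) that by (auto simp: character_on_def)
  have none: "{j \<in> J. \<forall>g\<in>carrier G. \<psi> j g * inverse (\<theta> g) = 1} = {}"
    using \<theta>(4) nz by (auto simp: field_simps)
  have "w2 - w1 dvd
      int (card {j \<in> J. \<forall>g\<in>carrier G. \<psi> j g * inverse (\<theta> g) = 1} * card (carrier G)) - w2"
    by (rule two_valued_defect_dvd[OF fin finJ chars W in_values _ character_on_inverse[OF \<theta>(1)] \<theta>(2)])
      (use w \<theta>(3) in auto)
  then have w2: "w2 - w1 dvd w2" unfolding none by simp
  have "J \<noteq> {}"
    using W[OF g1(1)] g1(2) w(1) by auto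
  then obtain i where i: "i \<in> J" by blast
  obtain h' where h': "h' \<in> carrier G" "\<psi> i h' \<noteq> 1" using nontrivial[OF i] by blast
  have nz: "\<psi> i g \<noteq> 0" if "g \<in> carrier G" for g
    using chars[OF i] that by (auto simp: character_on_def)
  have single: "{j \<in> J. \<forall>g\<in>carrier G. \<psi> j g * inverse (\<psi> i g) = 1} = {i}"
  proof (intro equalityI subsetI)
    fix j assume j: "j \<in> {j \<in> J. \<forall>g\<in>carrier G. \<psi> j g * inverse (\<psi> i g) = 1}"
    then have "\<psi> j g = \<psi> i g" if "g \<in> carrier G" for g
      using nz[OF that] that by (simp add: field_simps)
    then show "j \<in> {i}" using distinct[of j i] i j by blast
  qed (use i nz in simp)
  have "w2 - w1 dvd
      int (card {j \<in> J. \<forall>g\<in>carrier G. \<psi> j g * inverse (\<psi> i g) = 1} * card (carrier G)) - w2"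
    by (rule two_valued_defect_dvd[OF fin finJ chars W in_values _ character_on_inverse[OF chars[OF i]] h'(1)])
      (use w h'(2) in auto)
  then have "w2 - w1 dvd int (card (carrier G)) - w2" unfolding single by simp
  from dvd_add[OF this w2] have "w2 - w1 dvd int (card (carrier G))" by simp
  with \<open>0 < w1\<close> w2 show ?thesis by blast
qed

end

section \<open>Principal left ideals and units of a finite ring\<close>

lemma mem_left_principal_ideal_iff:
  "z \<in> left_principal_ideal x \<longleftrightarrow> left_principal_ideal z \<subseteq> left_principal_ideal x"
proof
  assume "z \<in> left_principal_ideal x"
  then obtain r where "z = r * x" by (auto simp: left_principal_ideal_def)
  then have "s * z = (s * r) * x" for s by (simp add: mult.assoc)
  then show "left_principal_ideal z \<subseteq> left_principal_ideal x"
    by (auto simp: left_principal_ideal_def)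
next
  have "z \<in> left_principal_ideal z"
    by (auto simp: left_principal_ideal_def intro!: exI[of _ 1])
  then show "left_principal_ideal z \<subseteq> left_principal_ideal x \<Longrightarrow> z \<in> left_principal_ideal x"
    by blast
qed

text \<open>Every element of a principal left ideal generates exactly one principal left ideal, and this one is
  contained in the given ideal.\<close>

lemma sum_by_generated_ideal:
  fixes f :: "'a::{ring_1,finite} \<Rightarrow> 'b::comm_monoid_add"
  assumes "I \<in> left_principal_ideals"
  shows "(\<Sum>z | z \<in> I \<and> P z. f z) =
         (\<Sum>K | K \<in> left_principal_ideals \<and> K \<subseteq> I. \<Sum>z | left_principal_ideal z = K \<and> P z. f z)"
proof -
  have "(\<Sum>z | z \<in> I \<and> P z. f z) =
        (\<Sum>K | K \<in> left_principal_ideals \<and> K \<subseteq> I.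
           \<Sum>z | z \<in> {z. z \<in> I \<and> P z} \<and> left_principal_ideal z = K. f z)"
    using assms
    by (intro sum.group[symmetric])
      (auto simp: left_principal_ideals_def mem_left_principal_ideal_iff)
  also have "\<dots> = (\<Sum>K | K \<in> left_principal_ideals \<and> K \<subseteq> I.
                    \<Sum>z | left_principal_ideal z = K \<and> P z. f z)"
    using assms
    by (intro sum.cong) (auto simp: left_principal_ideals_def mem_left_principal_ideal_iff)
  finally show ?thesis .
qed

lemma finite_ring_inverse_commute:
  fixes u v :: "'a::{ring_1,finite}"
  assumes "u * v = 1" shows "v * u = 1"
proof -
  have "inj ((*) v)"
  proof (rule injI)
    fix x y assume "v * x = v * y"
    then have "u * (v * x) = u * (v * y)" by simp
    then show "x = y" by (simp add: mult.assoc[symmetric] assms)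
  qed
  then have "surj ((*) v)" by (rule finite_UNIV_inj_surj[OF finite])
  then obtain y where "v * y = 1" by (metis surjD)
  then show ?thesis using assms by (metis mult.assoc mult_1_left mult_1_right)
qed

lemma ring_units_iff_left_inverse:
  fixes u :: "'a::{ring_1,finite}"
  shows "u \<in> ring_units \<longleftrightarrow> (\<exists>v. v * u = 1)"
  using finite_ring_inverse_commute by (auto simp: ring_units_def)

text \<open>This is the key to comparing generators: it transfers the existence of a unit \<open>z\<close> with \<open>z * a = a\<close>,
  namely \<open>z = 1\<close>, to the existence of a unit with \<open>z * a = b\<close>. The proof is by induction on \<open>I\<close>.
  If \<open>I a\<close> is smaller than \<open>R a\<close>, then both sets are empty. Otherwise \<open>z \<mapsto> z * a\<close> is a surjective
  additive map from \<open>I\<close> to \<open>R a\<close>, so its fibres over \<open>a\<close> and \<open>b\<close> have the same size. Sorting the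
  elements of both fibres by the left ideals that they generate, all proper parts agree by the induction
  hypothesis, and so do the remaining ones.\<close>

lemma card_generators_mapping_eq:
  fixes a b :: "'a::{ring_1,finite}"
  assumes ab: "left_principal_ideal a = left_principal_ideal b" and I: "I \<in> left_principal_ideals"
  shows "card {z. left_principal_ideal z = I \<and> z * a = b} =
         card {z. left_principal_ideal z = I \<and> z * a = a}"
  using finite[of I] I
proof (induction I rule: finite_psubset_induct)
  case (psubset I)
  let ?N = "\<lambda>K t. card {z. left_principal_ideal z = K \<and> z * a = t}"
  show ?case
  proof (cases "(\<lambda>z. z * a) ` I = left_principal_ideal a")
    case False
    have empty: "{z. left_principal_ideal z = I \<and> z * a = t} = {}"
      if t: "left_principal_ideal t = left_principal_ideal a" for t
    proof (rule ccontr)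
      assume "{z. left_principal_ideal z = I \<and> z * a = t} \<noteq> {}"
      then obtain z where z: "left_principal_ideal z = I" "z * a = t" by blast
      then have "(\<lambda>z. z * a) ` I = left_principal_ideal t"
        by (force simp: left_principal_ideal_def mult.assoc)
      with t False show False by simp
    qed
    show ?thesis using empty[OF refl] empty[OF ab[symmetric]] by (simp only:)
  next
    case True
    obtain c where c: "I = left_principal_ideal c"
      using psubset.prems by (auto simp: left_principal_ideals_def)
    have "b \<in> left_principal_ideal a"
      using ab by (simp add: mem_left_principal_ideal_iff)
    then obtain s where "b = s * a" by (auto simp: left_principal_ideal_def)
    then have "b - a = (s - 1) * a" by (simp add: algebra_simps)
    then have "b - a \<in> (\<lambda>z. z * a) ` I" unfolding True by (auto simp: left_principal_ideal_def)
    then obtain z\<^sub>0 where z\<^sub>0: "z\<^sub>0 \<in> I" "b - a = z\<^sub>0 * a" by blast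
    have add: "x + y \<in> I" and diff: "x - y \<in> I" if "x \<in> I" "y \<in> I" for x y
      using that unfolding c left_principal_ideal_def
      by (auto simp: distrib_right[symmetric] left_diff_distrib[symmetric])
    have "bij_betw (\<lambda>z. z + z\<^sub>0) {z. z \<in> I \<and> z * a = a} {z. z \<in> I \<and> z * a = b}"
      by (rule bij_betw_byWitness[of _ "\<lambda>z. z - z\<^sub>0"])
        (use z\<^sub>0 add diff in \<open>auto simp: distrib_right left_diff_distrib z\<^sub>0(2)[symmetric]\<close>)
    then have "card {z. z \<in> I \<and> z * a = b} = card {z. z \<in> I \<and> z * a = a}"
      by (simp add: bij_betw_same_card)
    moreover have "card {z. z \<in> I \<and> z * a = t} =
        ?N I t + (\<Sum>K | K \<in> left_principal_ideals \<and> K \<subset> I. ?N K t)" for t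
    proof -
      have "{K. K \<in> left_principal_ideals \<and> K \<subseteq> I} =
            insert I {K. K \<in> left_principal_ideals \<and> K \<subset> I}"
        using psubset.prems by auto
      then show ?thesis
        using sum_by_generated_ideal[OF psubset.prems, of "\<lambda>_. 1::nat" "\<lambda>z. z * a = t"] by simp
    qed
    moreover have "(\<Sum>K | K \<in> left_principal_ideals \<and> K \<subset> I. ?N K b) =
                   (\<Sum>K | K \<in> left_principal_ideals \<and> K \<subset> I. ?N K a)"
      by (rule sum.cong) (use psubset.IH in auto)
    ultimately show ?thesis by simp
  qed
qed

text \<open>The elements \<open>z\<close> with \<open>R z = R\<close> are the units, and 1 is one of them that maps \<open>a\<close> to \<open>a\<close>.
  So there is also one that maps \<open>a\<close> to \<open>b\<close>.\<close>

lemma left_principal_ideal_eq_iff_associated: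
  fixes a b :: "'a::{ring_1,finite}"
  shows "left_principal_ideal b = left_principal_ideal a \<longleftrightarrow> (\<exists>u\<in>ring_units. b = u * a)"
proof
  assume eq: "left_principal_ideal b = left_principal_ideal a"
  have "1 \<in> {z. left_principal_ideal z = left_principal_ideal 1 \<and> z * a = a}" by simp
  then have "card {z. left_principal_ideal z = left_principal_ideal 1 \<and> z * a = a} > 0"
    by (metis card_gt_0_iff empty_iff finite)
  then have "card {z. left_principal_ideal z = left_principal_ideal 1 \<and> z * a = b} > 0"
    using card_generators_mapping_eq[OF eq[symmetric], of "left_principal_ideal 1"]
    by (simp add: left_principal_ideals_def)
  then obtain z where z: "left_principal_ideal z = left_principal_ideal 1" "z * a = b"
    by (metis (mono_tags, lifting) card_gt_0_iff empty_Collect_eq)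
  from z(1) have "1 \<in> left_principal_ideal z" by (simp add: mem_left_principal_ideal_iff)
  then obtain r where "r * z = 1" by (auto simp: left_principal_ideal_def)
  then have "z \<in> ring_units" by (auto simp: ring_units_iff_left_inverse)
  with z(2) show "\<exists>u\<in>ring_units. b = u * a" by blast
next
  assume "\<exists>u\<in>ring_units. b = u * a"
  then obtain u v where b: "b = u * a" and v: "v * u = 1" by (auto simp: ring_units_def)
  have "b \<in> left_principal_ideal a" "a \<in> left_principal_ideal b"
  proof -
    show "b \<in> left_principal_ideal a" using b by (auto simp: left_principal_ideal_def)
    have "a = v * b" using b v by (simp add: mult.assoc[symmetric])
    then show "a \<in> left_principal_ideal b" by (auto simp: left_principal_ideal_def)
  qed
  then show "left_principal_ideal b = left_principal_ideal a"
    by (simp add: mem_left_principal_ideal_iff)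
qed

text \<open>After exchanging the two sums, the coefficient of \<open>f K\<close> is the sum of the Moebius function over
  the interval from \<open>K\<close> to \<open>B\<close>, which vanishes unless \<open>K = B\<close>.\<close>

lemma lpi_moebius_inversion:
  fixes f :: "'a::{ring_1,finite} set \<Rightarrow> 'b::comm_ring_1"
  assumes B: "B \<in> left_principal_ideals"
  shows "(\<Sum>I | I \<in> left_principal_ideals \<and> I \<subseteq> B.
            (\<Sum>K | K \<in> left_principal_ideals \<and> K \<subseteq> I. f K) * of_int (lpi_moebius I B)) = f B"
    (is "?lhs = _")
proof -
  let ?L = "left_principal_ideals :: 'a set set"
  have inner: "(\<Sum>I | I \<in> ?L \<and> K \<subseteq> I \<and> I \<subseteq> B. lpi_moebius I B) = (if K = B then 1 else 0)"
    if K: "K \<in> ?L" "K \<subseteq> B" for K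
  proof -
    obtain x where x: "B = left_principal_ideal x" using B by (auto simp: left_principal_ideals_def)
    obtain y where y: "K = left_principal_ideal y" using K(1) by (auto simp: left_principal_ideals_def)
    note xy = x y
    show ?thesis
    proof (cases "K = B")
      case True
      then have "{I. I \<in> ?L \<and> K \<subseteq> I \<and> I \<subseteq> B} = {B}" using B by auto
      then show ?thesis using True lpi_moebius_char(1)[of x] xy by simp
    next
      case False
      then have "K \<subset> B" using that by auto
      then show ?thesis using lpi_moebius_char(3)[of y x] False by (simp add: xy)
    qed
  qed
  have "?lhs = (\<Sum>I | I \<in> ?L \<and> I \<subseteq> B. \<Sum>K | K \<in> {K. K \<in> ?L \<and> K \<subseteq> B} \<and> K \<subseteq> I.
                  f K * of_int (lpi_moebius I B))"
    unfolding sum_distrib_right by (intro sum.cong refl) auto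
  also have "\<dots> = (\<Sum>K | K \<in> ?L \<and> K \<subseteq> B. \<Sum>I | I \<in> {I. I \<in> ?L \<and> I \<subseteq> B} \<and> K \<subseteq> I.
                     f K * of_int (lpi_moebius I B))"
    using sum.swap_restrict[of "{I. I \<in> ?L \<and> I \<subseteq> B}" "{K. K \<in> ?L \<and> K \<subseteq> B}"
        "\<lambda>I K. f K * of_int (lpi_moebius I B)" "\<lambda>I K. K \<subseteq> I"] by simp
  also have "\<dots> = (\<Sum>K | K \<in> ?L \<and> K \<subseteq> B.
                     f K * of_int (\<Sum>I | I \<in> ?L \<and> K \<subseteq> I \<and> I \<subseteq> B. lpi_moebius I B))"
    unfolding of_int_sum sum_distrib_left by (intro sum.cong refl) auto
  also have "\<dots> = (\<Sum>K | K \<in> ?L \<and> K \<subseteq> B. if K = B then f K else 0)"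
    by (rule sum.cong) (auto simp: inner)
  also have "\<dots> = f B" using B by simp
  finally show ?thesis .
qed

text \<open>Each point of the orbit of \<open>x\<close> is hit as often as \<open>x\<close> itself, by a coset of the stabiliser.\<close>

lemma sum_over_units_eq_sum_over_orbit:
  fixes x :: "'a::{ring_1,finite}" and h :: "'a \<Rightarrow> 'b::comm_semiring_1"
  shows "(\<Sum>u\<in>ring_units. h (u * x)) =
         of_nat (card {u \<in> ring_units. u * x = x}) * (\<Sum>z\<in>{u * x | u. u \<in> ring_units}. h z)"
proof -
  let ?U = "ring_units :: 'a set"
  have fibre: "card {u \<in> ?U. u * x = z} = card {u \<in> ?U. u * x = x}" if "z \<in> (\<lambda>u. u * x) ` ?U" for z
  proof -
    obtain v v' where z: "z = v * x" and v: "v * v' = 1" "v' * v = 1"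
      using \<open>z \<in> _\<close> by (auto simp: ring_units_def)
    have mult: "a * b \<in> ?U" if "a \<in> ?U" "b \<in> ?U" for a b
      using that by (auto simp: ring_units_def) (metis mult.assoc mult_1_left)
    have units: "v \<in> ?U" "v' \<in> ?U" using v by (auto simp: ring_units_def)
    have "v * (v' * t) = t" "v' * (v * t) = t" for t
      using v by (simp_all add: mult.assoc[symmetric])
    then have "bij_betw ((*) v) {u \<in> ?U. u * x = x} {u \<in> ?U. u * x = z}"
      by (intro bij_betw_byWitness[of _ "(*) v'"]) (auto simp: z mult units mult.assoc)
    then show ?thesis by (simp add: bij_betw_same_card)
  qed
  have "(\<Sum>u\<in>?U. h (u * x)) = (\<Sum>z\<in>(\<lambda>u. u * x) ` ?U. \<Sum>u | u \<in> ?U \<and> u * x = z. h (u * x))"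
    by (rule sum.image_gen) simp
  also have "\<dots> = (\<Sum>z\<in>(\<lambda>u. u * x) ` ?U. of_nat (card {u \<in> ?U. u * x = x}) * h z)"
    by (intro sum.cong refl) (simp add: fibre[symmetric])
  also have "(\<lambda>u. u * x) ` ?U = {u * x | u. u \<in> ?U}" by auto
  finally show ?thesis by (simp add: sum_distrib_left)
qed

section \<open>Generating characters and the homogeneous weight\<close>

text \<open>In a Frobenius ring this holds for the character that corresponds to 1 under an isomorphism from the ring
  to its character module: then \<open>r\<close> corresponds to \<open>x \<mapsto> \<chi> (x * r)\<close>, and the two last conditions
  are injectivity and surjectivity.\<close>

locale generating_character =
  fixes \<chi> :: "'a::{ring_1,finite} \<Rightarrow> complex"
  assumes additive: "additive_character \<chi>"
    and left_generating: "(\<And>x. \<chi> (x * r) = 1) \<Longrightarrow> r = 0"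
    and every_character: "additive_character \<psi> \<Longrightarrow> \<exists>r. \<psi> = (\<lambda>x. \<chi> (x * r))"

lemma frobenius_ring_generating_character:
  assumes "frobenius_ring (TYPE('a::{ring_1,finite}))"
  obtains \<chi> :: "'a::{ring_1,finite} \<Rightarrow> complex" where "generating_character \<chi>"
proof -
  obtain \<phi> :: "'a \<Rightarrow> 'a \<Rightarrow> complex" where bij: "bij_betw \<phi> UNIV {\<chi>. additive_character \<chi>}"
    and add: "\<And>x y. \<phi> (x + y) = (\<lambda>z. \<phi> x z * \<phi> y z)"
    and scale: "\<And>r x. \<phi> (r * x) = char_scale r (\<phi> x)"
    using assms unfolding frobenius_ring_def by blast
  have \<phi>: "\<phi> r = (\<lambda>x. \<phi> 1 (x * r))" for r
    using scale[of r 1] by (simp add: char_scale_def)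
  have char: "additive_character (\<phi> r)" for r
    using bij_betwE[OF bij] by blast
  have "generating_character (\<phi> 1)"
  proof
    show "additive_character (\<phi> 1)" by (rule char)
    show "r = 0" if "\<And>x. \<phi> 1 (x * r) = 1" for r
    proof -
      have "\<phi> r = (\<lambda>_. 1)" using that by (subst \<phi>) simp
      moreover have "\<phi> 0 = (\<lambda>_. 1)"
      proof
        fix z
        have "\<phi> 0 z * \<phi> 0 z = \<phi> 0 z" using add[of 0 0] by (metis add_0)
        moreover have "\<phi> 0 z \<noteq> 0" using char by (auto simp: additive_character_def)
        ultimately show "\<phi> 0 z = 1" by simp
      qed
      ultimately have "\<phi> r = \<phi> 0" by simp
      with bij show "r = 0" by (simp add: bij_betw_def inj_eq)
    qed
    show "\<exists>r. \<psi> = (\<lambda>x. \<phi> 1 (x * r))" if "additive_character \<psi>" for \<psi>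
    proof -
      have "\<psi> \<in> range \<phi>" using bij that by (simp add: bij_betw_def)
      then show ?thesis using \<phi> by blast
    qed
  qed
  then show thesis by (rule that)
qed

context generating_character
begin

lemma nonzero: "\<chi> x \<noteq> 0" and add: "\<chi> (x + y) = \<chi> x * \<chi> y"
  using additive by (auto simp: additive_character_def)

lemma zero [simp]: "\<chi> 0 = 1"
  using add[of 0 0] nonzero[of 0] by simp

lemma diff: "\<chi> (x - y) = \<chi> x / \<chi> y"
  using add[of "x - y" y] nonzero[of y] by (simp add: field_simps)

lemma sum_left_principal_ideal:
  "(\<Sum>z\<in>left_principal_ideal x. \<chi> z) = (if x = 0 then 1 else 0)"
proof (cases "x = 0")
  case True
  then show ?thesis by (simp add: left_principal_ideal_def)
next
  case False
  then obtain r where r: "\<chi> (r * x) \<noteq> 1" using left_generating by blast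
  have "(\<Sum>z\<in>left_principal_ideal x. \<chi> z) = 0"
  proof (rule sum_eq_0_if_scaled_by_permutation)
    show "bij_betw (\<lambda>z. r * x + z) (left_principal_ideal x) (left_principal_ideal x)"
      by (rule bij_betw_byWitness[of _ "\<lambda>z. z - r * x"])
        (auto simp: left_principal_ideal_def distrib_right[symmetric] left_diff_distrib[symmetric])
  qed (use r add in auto)
  with False show ?thesis by simp
qed

text \<open>Sum \<open>\<chi> (x * r)\<close> over all pairs. Summing over \<open>x\<close> first leaves only \<open>r = 0\<close>, which contributes
  \<open>|R|\<close>. Summing over \<open>r\<close> first, every \<open>x\<close> with \<open>\<chi> (x * r) = 1\<close> for all \<open>r\<close> contributes \<open>|R|\<close>.
  Hence 0 is the only such \<open>x\<close>.\<close>

lemma right_generating: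
  assumes "\<And>r. \<chi> (a * r) = 1"
  shows "a = 0"
proof -
  have col: "(\<Sum>x\<in>UNIV. \<chi> (x * r)) = (if r = 0 then of_nat (card (UNIV :: 'a set)) else 0)" for r
  proof (cases "r = 0")
    case False
    then obtain y where y: "\<chi> (y * r) \<noteq> 1" using left_generating by blast
    have "(\<Sum>x\<in>UNIV. \<chi> (x * r)) = 0"
      by (rule sum_eq_0_if_scaled_by_permutation[of "(+) y" _ _ "\<chi> (y * r)"])
        (use y in \<open>auto simp: distrib_right add\<close>)
    with False show ?thesis by simp
  qed simp
  have row: "(\<Sum>r\<in>UNIV. \<chi> (x * r)) = (if \<forall>r. \<chi> (x * r) = 1 then of_nat (card (UNIV :: 'a set)) else 0)" for x
  proof (cases "\<forall>r. \<chi> (x * r) = 1")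
    case False
    then obtain s where s: "\<chi> (x * s) \<noteq> 1" by blast
    have "(\<Sum>r\<in>UNIV. \<chi> (x * r)) = 0"
      by (rule sum_eq_0_if_scaled_by_permutation[of "(+) s" _ _ "\<chi> (x * s)"])
        (use s in \<open>auto simp: distrib_left add\<close>)
    with False show ?thesis by simp
  qed simp
  let ?A = "{x. \<forall>r. \<chi> (x * r) = 1}"
  have "of_nat (card ?A * card (UNIV :: 'a set)) = (\<Sum>x\<in>UNIV. \<Sum>r\<in>UNIV. \<chi> (x * r))"
    by (simp add: row sum.If_cases)
  also have "\<dots> = (\<Sum>r\<in>UNIV. \<Sum>x\<in>UNIV. \<chi> (x * r))"
    by (rule sum.swap)
  also have "\<dots> = of_nat (card (UNIV :: 'a set))"
    by (simp add: col)
  finally have "card ?A * card (UNIV :: 'a set) = card (UNIV :: 'a set)"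
    unfolding of_nat_eq_iff .
  then have "card ?A = 1" by simp
  moreover have "0 \<in> ?A" "a \<in> ?A" using assms by simp_all
  ultimately show "a = 0" by (metis (no_types, lifting) card_1_singletonE singletonD)
qed

text \<open>Sending \<open>r\<close> to the character \<open>x \<mapsto> \<chi> (x * r)\<close> or to \<open>x \<mapsto> \<chi> (r * x)\<close> is injective in both
  cases, and the first map reaches all characters; by counting, so does the second. So each \<open>u\<close> has a partner \<open>\<tau> u\<close> with \<open>\<chi> (x * u) = \<chi> (\<tau> u * x)\<close> for all \<open>x\<close>. If \<open>u\<close>
  is a unit, then its partner is not a left zero divisor and hence a unit, so \<open>\<tau>\<close> permutes the units.\<close>

lemma sum_over_units_commute: "(\<Sum>u\<in>ring_units. \<chi> (u * x)) = (\<Sum>u\<in>ring_units. \<chi> (x * u))"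
proof -
  let ?U = "ring_units :: 'a set"
  let ?left = "\<lambda>r x. \<chi> (x * r)" and ?right = "\<lambda>r x. \<chi> (r * x)"
  have inj_left: "inj ?left"
  proof (rule injI)
    fix r s assume "?left r = ?left s"
    then have "\<chi> (x * (r - s)) = 1" for x
      by (metis diff nonzero right_diff_distrib divide_self)
    then have "r - s = 0" by (rule left_generating)
    then show "r = s" by simp
  qed
  have inj_right: "inj ?right"
  proof (rule injI)
    fix r s assume "?right r = ?right s"
    then have "\<chi> ((r - s) * x) = 1" for x
      by (metis diff nonzero left_diff_distrib divide_self)
    then have "r - s = 0" by (rule right_generating)
    then show "r = s" by simp
  qed
  have "range ?right \<subseteq> range ?left"
  proof
    fix \<psi> assume "\<psi> \<in> range ?right"
    then have "additive_character \<psi>"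
      by (auto simp: additive_character_def nonzero add distrib_left)
    then show "\<psi> \<in> range ?left" using every_character by blast
  qed
  moreover have "card (range ?right) = card (range ?left)"
    by (simp add: card_image inj_left inj_right)
  ultimately have "range ?right = range ?left"
    by (intro card_subset_eq) simp_all
  then have "\<forall>u. \<exists>r. \<forall>x. \<chi> (x * u) = \<chi> (r * x)"
    by (metis (no_types, lifting) rangeE rangeI)
  then obtain \<tau> where \<tau>: "\<And>u x. \<chi> (x * u) = \<chi> (\<tau> u * x)" by metis
  have "\<tau> ` ?U \<subseteq> ?U"
  proof
    fix r assume "r \<in> \<tau> ` ?U"
    then obtain u v where r: "r = \<tau> u" and v: "v * u = 1" by (auto simp: ring_units_def)
    have "inj ((*) r)"
    proof (rule injI)
      fix y z assume "r * y = r * z"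
      then have "r * ((y - z) * t) = 0" for t by (simp add: mult.assoc[symmetric] right_diff_distrib)
      then have "\<chi> ((y - z) * t * u) = 1" for t by (simp add: \<tau> r)
      from this[of "t * v" for t] have "\<chi> ((y - z) * t) = 1" for t by (simp add: mult.assoc v)
      then have "y - z = 0" by (rule right_generating)
      then show "y = z" by simp
    qed
    then have "surj ((*) r)" by (rule finite_UNIV_inj_surj[OF finite])
    then obtain y where "r * y = 1" by (metis surjD)
    then show "r \<in> ?U" using finite_ring_inverse_commute by (auto simp: ring_units_def)
  qed
  moreover have "inj_on \<tau> ?U"
  proof (rule inj_onI)
    fix u v assume "\<tau> u = \<tau> v"
    then have "?left u = ?left v" by (intro ext) (metis \<tau>)
    then show "u = v" by (rule injD[OF inj_left])
  qed
  ultimately have "bij_betw \<tau> ?U ?U"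
    by (simp add: bij_betw_def endo_inj_surj)
  then have "(\<Sum>u\<in>?U. \<chi> (u * x)) = (\<Sum>u\<in>?U. \<chi> (\<tau> u * x))"
    using sum.reindex_bij_betw[of \<tau> ?U ?U "\<lambda>u. \<chi> (u * x)"] by simp
  then show ?thesis by (simp only: \<tau>[symmetric])
qed

text \<open>The sum of \<open>\<chi>\<close> over a principal left ideal is 0 unless the ideal is zero. Sorting the summands by
  the ideals that they generate, Moebius inversion yields the sum over the generators of a
  single ideal, and these form an orbit of the unit group.\<close>

lemma lpi_moebius_eq_sum_orbit:
  "of_int (lpi_moebius {0} (left_principal_ideal x)) = (\<Sum>z\<in>{u * x | u. u \<in> ring_units}. \<chi> z)"
proof -
  let ?L = "left_principal_ideals :: 'a set set" and ?B = "left_principal_ideal x"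
  let ?f = "\<lambda>K. \<Sum>z | left_principal_ideal z = K. \<chi> z"
  have B: "?B \<in> ?L" by (simp add: left_principal_ideals_def)
  have zero_ideal: "left_principal_ideal z = {0} \<longleftrightarrow> z = 0" for z :: 'a
    using mem_left_principal_ideal_iff[of z z] by (auto simp: left_principal_ideal_def)
  have total: "(\<Sum>K | K \<in> ?L \<and> K \<subseteq> I. ?f K) = (if I = {0} then 1 else 0)" if I: "I \<in> ?L" for I
  proof -
    obtain y where y: "I = left_principal_ideal y" using I by (auto simp: left_principal_ideals_def)
    show ?thesis
      using sum_by_generated_ideal[OF I, of \<chi> "\<lambda>_. True"] sum_left_principal_ideal[of y] zero_ideal[of y]
      by (simp add: y)
  qed
  have zero_in: "{0} \<in> ?L" "0 \<in> ?B"
    using zero_ideal[of 0]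
    by (metis left_principal_ideals_def rangeI)
      (auto simp: left_principal_ideal_def intro!: exI[of _ 0])
  have "?f ?B = (\<Sum>I | I \<in> ?L \<and> I \<subseteq> ?B.
            (\<Sum>K | K \<in> ?L \<and> K \<subseteq> I. ?f K) * of_int (lpi_moebius I ?B))"
    by (rule lpi_moebius_inversion[OF B, symmetric])
  also have "\<dots> = (\<Sum>I | I \<in> ?L \<and> I \<subseteq> ?B. if I = {0} then of_int (lpi_moebius I ?B) else 0)"
    by (rule sum.cong) (auto simp: total)
  also have "\<dots> = of_int (lpi_moebius {0} ?B)"
    using zero_in by simp
  finally show ?thesis
    by (simp add: left_principal_ideal_eq_iff_associated Bex_def conj_commute)
qed

text \<open>The stabiliser of \<open>x\<close> has order \<open>|U| / |U x|\<close>, which turns the quotient in the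
  definition of the weight into the integer multiple of the Moebius function that the
  sum over the units produces.\<close>

lemma hom_weight_eq_unit_sum:
  obtains m :: int where "hom_weight (real (card (ring_units :: 'a set))) x = of_int m"
    and "of_int m = of_nat (card (ring_units :: 'a set)) - (\<Sum>u\<in>ring_units. \<chi> (x * u))"
proof
  let ?U = "ring_units :: 'a set" and ?O = "{u * x | u. u \<in> ring_units}"
    and ?\<mu> = "lpi_moebius {0} (left_principal_ideal x)"
  let ?s = "card {u \<in> ?U. u * x = x}"
  have "1 \<in> ?U" by (simp add: ring_units_def)
  then have "?O \<noteq> {}" by blast
  then have O: "card ?O \<noteq> 0" by simp
  have U: "card ?U = ?s * card ?O"
    using sum_over_units_eq_sum_over_orbit[of "\<lambda>_. 1::nat" x] by simp
  show "hom_weight (real (card ?U)) x = of_int (int (card ?U) - int ?s * ?\<mu>)"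
    using O by (simp add: hom_weight_def U field_simps)
  have "(\<Sum>u\<in>?U. \<chi> (x * u)) = of_nat ?s * of_int ?\<mu>"
    by (simp add: sum_over_units_commute[symmetric] sum_over_units_eq_sum_over_orbit
        lpi_moebius_eq_sum_orbit)
  then show "of_int (int (card ?U) - int ?s * ?\<mu>) = of_nat (card ?U) - (\<Sum>u\<in>?U. \<chi> (x * u))"
    by simp
qed

end

section \<open>Two-weight codes\<close>

lemma group_of_left_linear_code:
  fixes C :: "'a::ring_1 vec set"
  assumes "left_linear_code n C"
  shows "group \<lparr>carrier = C, mult = (+), one = 0\<^sub>v n\<rparr>"
proof (rule groupI; simp)
  have C: "C \<subseteq> carrier_vec n" "0\<^sub>v n \<in> C" "\<And>c c'. c \<in> C \<Longrightarrow> c' \<in> C \<Longrightarrow> c + c' \<in> C"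
    "\<And>r c. c \<in> C \<Longrightarrow> r \<cdot>\<^sub>v c \<in> C"
    using assms by (auto simp: left_linear_code_def)
  show "0\<^sub>v n \<in> C" by (rule C(2))
  show "c + c' \<in> C" if "c \<in> C" "c' \<in> C" for c c' using that by (rule C(3))
  show "c + c' + c'' = c + (c' + c'')" if "c \<in> C" "c' \<in> C" "c'' \<in> C" for c c' c''
    using that C(1) by (intro assoc_add_vec[of _ n]) auto
  show "0\<^sub>v n + c = c" if "c \<in> C" for c
    using that C(1) by (intro left_zero_vec) auto
  show "\<exists>c'\<in>C. c' + c = 0\<^sub>v n" if "c \<in> C" for c
  proof
    show "(- 1) \<cdot>\<^sub>v c \<in> C" using that by (rule C(4))
    show "(- 1) \<cdot>\<^sub>v c + c = 0\<^sub>v n" using that C(1) by (intro eq_vecI) auto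
  qed
qed

context generating_character
begin

text \<open>If two of the characters agree on \<open>C\<close>, then the left ideal generated by
  \<open>c\<^sub>i * u - c\<^sub>j * v\<close> lies in the kernel of \<open>\<chi>\<close> for each codeword \<open>c\<close>, so it is zero. For \<open>i \<noteq> j\<close>
  this makes the columns \<open>i\<close> and \<open>j\<close> right multiples of each other, against projectivity; for
  \<open>i = j\<close>, a codeword with \<open>c\<^sub>i = 1\<close>, which exists by regularity, gives \<open>u = v\<close>.\<close>

lemma coordinate_characters_distinct:
  assumes code: "left_linear_code n C"
    and regular: "\<And>i. i < n \<Longrightarrow> (\<lambda>c. c $ i) ` C = UNIV"
    and projective: "\<And>i j. i < n \<Longrightarrow> j < n \<Longrightarrow> i \<noteq> j \<Longrightarrow>
      \<not> ((\<exists>r. \<forall>c\<in>C. c $ j = c $ i * r) \<and> (\<exists>r. \<forall>c\<in>C. c $ i = c $ j * r))"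
    and ij: "i < n" "j < n" and units: "u \<in> ring_units" "v \<in> ring_units"
    and eq: "\<And>c. c \<in> C \<Longrightarrow> \<chi> (c $ i * u) = \<chi> (c $ j * v)"
  shows "i = j \<and> u = v"
proof -
  have coords: "c $ i * u = c $ j * v" if "c \<in> C" for c
  proof -
    have "\<chi> (r * (c $ i * u - c $ j * v)) = 1" for r
    proof -
      have "r \<cdot>\<^sub>v c \<in> C" "dim_vec c = n"
        using code \<open>c \<in> C\<close> by (auto simp: left_linear_code_def)
      with eq[of "r \<cdot>\<^sub>v c"] ij have "\<chi> (r * (c $ i * u)) = \<chi> (r * (c $ j * v))"
        by (simp add: mult.assoc)
      then show ?thesis
        by (simp add: right_diff_distrib diff nonzero)
    qed
    then have "c $ i * u - c $ j * v = 0" by (rule left_generating)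
    then show ?thesis by simp
  qed
  obtain u' v' where u': "u * u' = 1" and v': "v * v' = 1"
    using units by (auto simp: ring_units_def)
  have "i = j"
  proof (rule ccontr)
    assume "i \<noteq> j"
    have "c $ j = c $ i * (u * v')" "c $ i = c $ j * (v * u')" if "c \<in> C" for c
      using coords[OF that] u' v' by (metis mult.assoc mult_1_right)+
    then show False using projective[OF ij \<open>i \<noteq> j\<close>] by blast
  qed
  moreover obtain c where "c \<in> C" "c $ i = 1"
    using regular[OF ij(1)] by (metis UNIV_I imageE)
  ultimately show ?thesis using coords[of c] by simp
qed

lemma vec_weight_eq_character_sum:
  fixes c :: "'a vec"
  assumes "dim_vec c = n"
  shows "\<exists>m::int. vec_weight (real (card (ring_units :: 'a set))) c = of_int m \<and>
    of_int m = of_nat (card ({..<n} \<times> (ring_units :: 'a set)))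
      - (\<Sum>(i, u)\<in>{..<n} \<times> ring_units. \<chi> (c $ i * u))"
proof -
  have "\<forall>x. \<exists>m::int. hom_weight (real (card (ring_units :: 'a set))) x = of_int m \<and>
      of_int m = of_nat (card (ring_units :: 'a set)) - (\<Sum>u\<in>ring_units. \<chi> (x * u))"
    by (metis hom_weight_eq_unit_sum)
  then obtain m :: "'a \<Rightarrow> int"
    where m: "\<And>x. hom_weight (real (card (ring_units :: 'a set))) x = of_int (m x)"
      "\<And>x. of_int (m x) = of_nat (card (ring_units :: 'a set)) - (\<Sum>u\<in>ring_units. \<chi> (x * u))"
    by metis
  show ?thesis
  proof (intro exI conjI)
    show "vec_weight (real (card (ring_units :: 'a set))) c = of_int (\<Sum>i<n. m (c $ i))"
      by (simp add: vec_weight_def m(1) assms)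
    show "of_int (\<Sum>i<n. m (c $ i)) = of_nat (card ({..<n} \<times> (ring_units :: 'a set)))
        - (\<Sum>(i, u)\<in>{..<n} \<times> ring_units. \<chi> (c $ i * u))"
      by (simp add: m(2) sum_subtractf sum.cartesian_product)
  qed
qed

end

theorem corollary16:
  fixes C :: "'a::{ring_1,finite} vec set" and n :: nat and \<gamma> w\<^sub>1 w\<^sub>2 :: real
  assumes "frobenius_ring TYPE('a)"
    and "\<gamma> = real (card (ring_units :: 'a set))"
    and "left_linear_code n C"
    and "proper_code \<gamma> n C"
    and "regular_code n C"
    and "projective_code n C"
    and "two_weight_code \<gamma> C w\<^sub>1 w\<^sub>2"
  shows "\<exists>d t :: nat. 0 < d \<and> 0 < t \<and> d dvd card C \<and>
           w\<^sub>1 = real (d * t) \<and> w\<^sub>2 = real (d * (t + 1))"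
proof -
  obtain \<chi> :: "'a \<Rightarrow> complex" where "generating_character \<chi>"
    using frobenius_ring_generating_character[OF assms(1)] .
  then interpret generating_character \<chi> .
  let ?U = "ring_units :: 'a set"
  \<comment> \<open>The type constraint keeps the element types of the record fields from diverging.\<close>
  let ?G = "\<lparr>carrier = C, mult = (+), one = 0\<^sub>v n\<rparr> :: 'a vec monoid"
  let ?J = "{..<n} \<times> ?U"
  let ?\<psi> = "\<lambda>(i, u). \<lambda>c. \<chi> (c $ i * u)"
  interpret G: group ?G by (rule group_of_left_linear_code[OF assms(3)])
  have dim: "dim_vec c = n" if "c \<in> C" for c
    using assms(3) that by (auto simp: left_linear_code_def)
  have "C \<subseteq> vec_of_list ` {xs. set xs \<subseteq> UNIV \<and> length xs = n}"
  proof
    fix c assume "c \<in> C"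
    then show "c \<in> vec_of_list ` {xs. set xs \<subseteq> UNIV \<and> length xs = n}"
      by (intro image_eqI[of _ _ "list_of_vec c"]) (simp_all add: vec_list dim)
  qed
  then have fin: "finite C"
    by (rule finite_subset) (intro finite_imageI finite_lists_length_eq finite)
  obtain l Y where Y: "generator_matrix l n C Y" "regular_matrix Y"
    using assms(5) by (auto simp: regular_code_def)
  have regular: "(\<lambda>c. c $ i) ` C = UNIV" if "i < n" for i
    using regular_matrix_iff[OF Y(1)] Y(2) that by simp
  have "projective_matrix Y"
    using projective_code_iff[OF Y(1)] assms(6) by simp
  moreover have "dim_col Y = n" using Y(1) by (auto simp: generator_matrix_def)
  ultimately have projective: "\<not> ((\<exists>r. \<forall>c\<in>C. c $ j = c $ i * r) \<and> (\<exists>r. \<forall>c\<in>C. c $ i = c $ j * r))"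
    if "i < n" "j < n" "i \<noteq> j" for i j
    using that right_span_col_subset_iff[OF Y(1) that(1,2)] right_span_col_subset_iff[OF Y(1) that(2,1)]
    unfolding projective_matrix_def by blast
  have "\<forall>c\<in>C. \<exists>m::int. vec_weight \<gamma> c = of_int m \<and>
      of_int m = of_nat (card ?J) - (\<Sum>(i, u)\<in>?J. \<chi> (c $ i * u))"
    using vec_weight_eq_character_sum[OF dim] assms(2) by blast
  then obtain W :: "'a vec \<Rightarrow> int" where W: "\<And>c. c \<in> C \<Longrightarrow> vec_weight \<gamma> c = of_int (W c)"
    and W_sum: "\<And>c. c \<in> C \<Longrightarrow> of_int (W c) = of_nat (card ?J) - (\<Sum>(i, u)\<in>?J. \<chi> (c $ i * u))"
    by metis
  have zero_in: "0\<^sub>v n \<in> C" using assms(3) by (simp add: left_linear_code_def)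
  have "of_int (W (0\<^sub>v n)) = of_nat (card ?J) - (\<Sum>(i, u)\<in>?J. (1::complex))"
    unfolding W_sum[OF zero_in]
    by (intro arg_cong2[of _ _ _ _ "(-)"] sum.cong refl) auto
  also have "\<dots> = 0" by (simp add: split_def)
  finally have W0: "W (0\<^sub>v n) = 0" by simp
  have weights: "vec_weight \<gamma> ` C - {0} = {w\<^sub>1, w\<^sub>2}" and less: "w\<^sub>1 < w\<^sub>2"
    using assms(7) by (auto simp: two_weight_code_def)
  have "w\<^sub>1 \<in> vec_weight \<gamma> ` C - {0}" "w\<^sub>2 \<in> vec_weight \<gamma> ` C - {0}"
    using weights by simp_all
  then obtain c1 c2 where c: "c1 \<in> C" "c2 \<in> C" "w\<^sub>1 = of_int (W c1)" "w\<^sub>2 = of_int (W c2)"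
    "W c1 \<noteq> 0" "W c2 \<noteq> 0"
    using W by auto
  have W_values: "W ` (C - {0\<^sub>v n}) = {W c1, W c2}"
  proof (intro equalityI subsetI)
    fix k assume "k \<in> W ` (C - {0\<^sub>v n})"
    then obtain x where x: "x \<in> C" "x \<noteq> 0\<^sub>v n" "k = W x" by blast
    then have "vec_weight \<gamma> x \<noteq> 0" using assms(4) by (auto simp: proper_code_def)
    then have "vec_weight \<gamma> x \<in> {w\<^sub>1, w\<^sub>2}" using x(1) weights by blast
    then show "k \<in> {W c1, W c2}" using W[OF x(1)] x(3) c(3,4) by auto
  next
    fix k assume "k \<in> {W c1, W c2}"
    then show "k \<in> W ` (C - {0\<^sub>v n})" using c W0 by auto
  qed
  have "0 < W c1 \<and> W c2 - W c1 dvd int (card (carrier ?G)) \<and> W c2 - W c1 dvd W c2"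
  proof (rule G.two_valued_character_sum[of ?J ?\<psi>])
    show "finite (carrier ?G)" using fin by simp
    show "finite ?J" by simp
    show "character_on ?G (?\<psi> p)" if "p \<in> ?J" for p
      using that by (auto simp: character_on_def nonzero add distrib_right dim)
    show "\<exists>g\<in>carrier ?G. ?\<psi> p g \<noteq> 1" if pJ: "p \<in> ?J" for p
    proof -
      obtain i u where p: "p = (i, u)" "i < n" "u \<in> ?U" using pJ by auto
      have "u \<noteq> 0" using p(3) by (auto simp: ring_units_def)
      then obtain x where x: "\<chi> (x * u) \<noteq> 1" using left_generating by blast
      obtain c where "c \<in> C" "c $ i = x" using regular[OF p(2)] by (metis UNIV_I imageE)
      then show ?thesis using x p(1) by auto
    qed
    show "\<exists>g\<in>carrier ?G. ?\<psi> p g \<noteq> ?\<psi> q g" if pq: "p \<in> ?J" "q \<in> ?J" "p \<noteq> q" for p q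
    proof (rule ccontr)
      assume same: "\<not> (\<exists>g\<in>carrier ?G. ?\<psi> p g \<noteq> ?\<psi> q g)"
      obtain i u j v where ij: "p = (i, u)" "q = (j, v)" "i < n" "j < n" "u \<in> ?U" "v \<in> ?U"
        using pq by auto
      have "i = j \<and> u = v"
        by (rule coordinate_characters_distinct[OF assms(3) regular projective ij(3-6)])
          (use same ij(1,2) in auto)
      with pq(3) ij(1,2) show False by simp
    qed
    show "of_int (W c) = of_nat (card ?J) - (\<Sum>p\<in>?J. ?\<psi> p c)" if "c \<in> carrier ?G" for c
      using W_sum[of c] that by (simp add: split_def)
    show "W ` (carrier ?G - {\<one>\<^bsub>?G\<^esub>}) = {W c1, W c2}" using W_values by simp
    show "W c1 < W c2" using less c(3,4) by simp
  qed (use c in simp_all)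
  then have dvd: "0 < W c1" "W c2 - W c1 dvd int (card C)" "W c2 - W c1 dvd W c2" by simp_all
  define d where "d = nat (W c2 - W c1)"
  have d: "int d = W c2 - W c1" "0 < d" using less c(3,4) by (simp_all add: d_def)
  have "int d dvd W c1" using dvd(3) d(1) by (metis dvd_diff_commute dvd_diff_right_iff dvd_refl)
  then obtain k where k: "W c1 = int d * k" by (elim dvdE)
  have "0 < k" using k dvd(1) d(2) by (simp add: zero_less_mult_iff)
  have "W c2 = W c1 + int d" using d(1) by simp
  then have "W c1 = int (d * nat k)" "W c2 = int (d * (nat k + 1))"
    using k \<open>0 < k\<close> by (simp_all add: distrib_left)
  then have "w\<^sub>1 = real (d * nat k)" "w\<^sub>2 = real (d * (nat k + 1))"
    using c(3,4) by simp_all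
  moreover have "d dvd card C" using dvd(2) d(1) by (metis int_dvd_int_iff)
  ultimately show ?thesis using d(2) \<open>0 < k\<close> by (intro exI[of _ d] exI[of _ "nat k"]) simp
qed

end
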